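(* For each $k\geq 16$, the set of subtransitive cyclic $k$-gons has measure zero in $\mathcal{P}$. In particular, there exists a cyclic $16$-gon which is not subtransitive.
   Context: A finite set $Z\subset\mathbb{R}^n$ is transitive if the group of isometries of $\mathbb{R}^n$ mapping $Z$ onto $Z$ acts transitively on $Z$. A finite set in $\mathbb{R}^d$ is subtransitive if it is congruent to a subset of a finite transitive set in some $\mathbb{R}^n$ (possibly with $n>d$); a polygon is subtransitive if its vertex set is. Cyclic $k$-gons are considered labelled and oriented: vertices are labelled $1,\dots,k$ in clockwise order, and two are identified if there is a label-preserving isometry between them. A cyclic $k$-gon $x_1\ldots x_k$ with circumcentre $x_0$ and circumradius $r$ is uniquely determined by $(r,\angle x_1x_0x_2,\dots,\angle x_1x_0x_k)$ (oriented angles), which identifies the set of cyclic $k$-gons with a subset $\mathcal{P}\subset\mathbb{R}^k$ of positive Lebesgue measure; measure means Lebesgue measure in $\mathbb{R}^k$. *)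

theory Defs
  imports "HOL-Analysis.Analysis"
begin

section \<open>Transitive and subtransitive sets\<close>

text \<open>
  Subtransitivity quantifies over the dimension \<open>n\<close> of the ambient space, so \<open>n\<close> cannot be a type.
  The points of \<open>n\<close>-dimensional real space are therefore the elements of
  \<open>topspace (Euclidean_space n)\<close>, i.e. the functions \<open>nat \<Rightarrow> real\<close> that vanish at
  all indices \<open>i \<ge> n\<close>.
\<close>

definition euclidean_dist :: "nat \<Rightarrow> (nat \<Rightarrow> real) \<Rightarrow> (nat \<Rightarrow> real) \<Rightarrow> real" where
  "euclidean_dist n x y = L2_set (\<lambda>i. x i - y i) {..<n}"

definition euclidean_isometry :: "nat \<Rightarrow> ((nat \<Rightarrow> real) \<Rightarrow> (nat \<Rightarrow> real)) \<Rightarrow> bool" where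
  "euclidean_isometry n g \<longleftrightarrow>
     bij_betw g (topspace (Euclidean_space n)) (topspace (Euclidean_space n)) \<and>
     (\<forall>x\<in>topspace (Euclidean_space n). \<forall>y\<in>topspace (Euclidean_space n).
        euclidean_dist n (g x) (g y) = euclidean_dist n x y)"

definition transitive_set :: "nat \<Rightarrow> (nat \<Rightarrow> real) set \<Rightarrow> bool" where
  "transitive_set n Z \<longleftrightarrow>
     Z \<subseteq> topspace (Euclidean_space n) \<and>
     (\<forall>x\<in>Z. \<forall>y\<in>Z. \<exists>g. euclidean_isometry n g \<and> g ` Z = Z \<and> g x = y)"

text \<open>
  The map \<open>f\<close> is the congruence from \<open>X\<close> onto the subset \<open>f ` X\<close> of \<open>Z\<close>.
\<close>

definition subtransitive :: "'a::euclidean_space set \<Rightarrow> bool" where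
  "subtransitive X \<longleftrightarrow>
     finite X \<and>
     (\<exists>n Z f. finite Z \<and> transitive_set n Z \<and> f ` X \<subseteq> Z \<and>
        (\<forall>x\<in>X. \<forall>y\<in>X. euclidean_dist n (f x) (f y) = dist x y))"

section \<open>Cyclic polygons\<close>

text \<open>
  The plane is \<^typ>\<open>complex\<close>, and a labelled \<open>k\<close>-gon is given by the values
  \<open>x 1, \<dots>, x k\<close> of a function \<open>x\<close>; the values at other indices play no role.
\<close>

text \<open>The angle in \<open>[0, 2\<pi>)\<close> of the clockwise rotation about \<open>c\<close> that takes \<open>a\<close> to \<open>b\<close>,
  for points \<open>a\<close>, \<open>b\<close> at the same positive distance from \<open>c\<close>.\<close>

definition clockwise_angle :: "complex \<Rightarrow> complex \<Rightarrow> complex \<Rightarrow> real" where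
  "clockwise_angle a c b = Arg2pi ((a - c) / (b - c))"

text \<open>\<open>x 1, \<dots>, x k\<close> are distinct points met in this order on a clockwise turn
  around a circle with centre \<open>c\<close> and radius \<open>r\<close>.\<close>

definition clockwise_on_circle :: "nat \<Rightarrow> (nat \<Rightarrow> complex) \<Rightarrow> complex \<Rightarrow> real \<Rightarrow> bool" where
  "clockwise_on_circle k x c r \<longleftrightarrow>
     r > 0 \<and> (\<forall>i\<in>{1..k}. dist c (x i) = r) \<and>
     strict_mono_on {1..k} (\<lambda>i. clockwise_angle (x 1) c (x i))"

definition cyclic_polygon :: "nat \<Rightarrow> (nat \<Rightarrow> complex) \<Rightarrow> bool" where
  "cyclic_polygon k x \<longleftrightarrow> k \<ge> 3 \<and> (\<exists>c r. clockwise_on_circle k x c r)"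

definition circumcentre :: "nat \<Rightarrow> (nat \<Rightarrow> complex) \<Rightarrow> complex" where
  "circumcentre k x = (THE c. \<exists>r. \<forall>i\<in>{1..k}. dist c (x i) = r)"

text \<open>
  The parameter vector of a cyclic \<open>k\<close>-gon: coordinate \<open>1\<close> is the circumradius, coordinate
  \<open>i\<close> for \<open>2 \<le> i \<le> k\<close> is the angle at the circumcentre from \<open>x 1\<close> to \<open>x i\<close>.
\<close>

definition polygon_params :: "nat \<Rightarrow> (nat \<Rightarrow> complex) \<Rightarrow> (nat \<Rightarrow> real)" where
  "polygon_params k x =
     (\<lambda>i\<in>{1..k}. if i = 1 then dist (circumcentre k x) (x 1)
                 else clockwise_angle (x 1) (circumcentre k x) (x i))"

text \<open>Lebesgue measure on \<open>k\<close>-dimensional space, with coordinates indexed by \<open>1, \<dots>, k\<close>.\<close>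

definition lebesgue_coords :: "nat \<Rightarrow> (nat \<Rightarrow> real) measure" where
  "lebesgue_coords k = completion (\<Pi>\<^sub>M i\<in>{1..k}. lborel)"

section \<open>The definitions describe the intended objects\<close>

lemma equidistant_point_unique:
  fixes a b c p q :: complex
  assumes "a \<noteq> b" "a \<noteq> c" "b \<noteq> c"
    and "dist p a = r" "dist p b = r" "dist p c = r"
    and "dist q a = s" "dist q b = s" "dist q c = s"
  shows "p = q"
proof (rule ccontr)
  assume "p \<noteq> q"
  have sq: "(Re (u - v))\<^sup>2 + (Im (u - v))\<^sup>2 = (dist u v)\<^sup>2" for u v :: complex
    by (simp add: dist_norm cmod_power2)
  define A B where "A = Re (p - q)" and "B = Im (p - q)"
  have AB: "A\<^sup>2 + B\<^sup>2 \<noteq> 0"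
    using \<open>p \<noteq> q\<close> by (auto simp: A_def B_def complex_eq_iff sum_power2_eq_zero_iff)
  have orth: "A * Re (v - a) + B * Im (v - a) = 0"
    if "dist p v = r" "dist q v = s" for v
    using sq[of p v] sq[of q v] sq[of p a] sq[of q a] that assms(4,7)
    by (simp add: A_def B_def power2_eq_square algebra_simps)
  have par: "\<exists>t. Re (v - a) = - t * B \<and> Im (v - a) = t * A"
    if "A * Re (v - a) + B * Im (v - a) = 0" for v
  proof (intro exI conjI)
    let ?t = "(A * Im (v - a) - B * Re (v - a)) / (A\<^sup>2 + B\<^sup>2)"
    let ?X = "Re (v - a)" and ?Y = "Im (v - a)"
    have "?X * (A\<^sup>2 + B\<^sup>2) = A * (A * ?X + B * ?Y) - (A * ?Y - B * ?X) * B"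
      and "?Y * (A\<^sup>2 + B\<^sup>2) = B * (A * ?X + B * ?Y) + (A * ?Y - B * ?X) * A"
      by algebra+
    then have "?X * (A\<^sup>2 + B\<^sup>2) = - (A * ?Y - B * ?X) * B"
      and "?Y * (A\<^sup>2 + B\<^sup>2) = (A * ?Y - B * ?X) * A"
      unfolding that by (simp_all only: mult_zero_right diff_0 add_0 mult_minus_left)
    then have "?X = - (A * ?Y - B * ?X) * B / (A\<^sup>2 + B\<^sup>2)"
      and "?Y = (A * ?Y - B * ?X) * A / (A\<^sup>2 + B\<^sup>2)"
      using AB by (metis nonzero_mult_div_cancel_right)+
    then show "?X = - ?t * B" "?Y = ?t * A"
      by (simp_all only: times_divide_eq_left minus_divide_left)
  qed
  define m where "m = B * Re (a - p) - A * Im (a - p)"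
  have val: "t * (A\<^sup>2 + B\<^sup>2) = 2 * m"
    if "v \<noteq> a" "dist p v = r" "Re (v - a) = - t * B" "Im (v - a) = t * A" for v t
  proof -
    have "t \<noteq> 0" using that by (auto simp: complex_eq_iff)
    have re: "Re (p - v) = - (Re (a - p) - t * B)" and im: "Im (p - v) = - (Im (a - p) + t * A)"
      using that(3,4) by simp_all
    have "(Re (a - p) - t * B)\<^sup>2 + (Im (a - p) + t * A)\<^sup>2 = (Re (a - p))\<^sup>2 + (Im (a - p))\<^sup>2"
      using sq[of p v] sq[of a p] that(2) assms(4) unfolding re im
      by (simp only: power2_minus dist_commute)
    then have "t * (t * (A\<^sup>2 + B\<^sup>2) - 2 * m) = 0"
      unfolding m_def by algebra
    with \<open>t \<noteq> 0\<close> show ?thesis by simp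
  qed
  obtain t where t: "Re (b - a) = - t * B" "Im (b - a) = t * A"
    using par[OF orth] assms by blast
  obtain u where u: "Re (c - a) = - u * B" "Im (c - a) = u * A"
    using par[OF orth] assms by blast
  have "t = u"
    using val[of b t] val[of c u] t u assms AB by (metis mult_right_cancel)
  with t u have "b - a = c - a"
    by (simp add: complex_eq_iff)
  with assms show False by simp
qed

lemma clockwise_on_circle_inj:
  assumes "clockwise_on_circle k x c r"
  shows "inj_on x {1..k}"
proof -
  have mono: "strict_mono_on {1..k} (\<lambda>i. clockwise_angle (x 1) c (x i))"
    using assms by (simp add: clockwise_on_circle_def)
  show ?thesis
    by (rule linorder_inj_onI) (use strict_mono_onD[OF mono] in fastforce)+
qed

lemma circumcentre_eq:
  assumes "k \<ge> 3" "clockwise_on_circle k x c r"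
  shows "circumcentre k x = c"
  unfolding circumcentre_def
proof (rule the_equality)
  show "\<exists>r. \<forall>i\<in>{1..k}. dist c (x i) = r"
    using assms by (auto simp: clockwise_on_circle_def)
next
  fix c' assume "\<exists>s. \<forall>i\<in>{1..k}. dist c' (x i) = s"
  then obtain s where s: "\<And>i. i \<in> {1..k} \<Longrightarrow> dist c' (x i) = s" by blast
  have r: "\<And>i. i \<in> {1..k} \<Longrightarrow> dist c (x i) = r"
    using assms by (auto simp: clockwise_on_circle_def)
  have mem: "1 \<in> {1..k}" "2 \<in> {1..k}" "3 \<in> {1..k}"
    using assms by auto
  have "x 1 \<noteq> x 2" "x 1 \<noteq> x 3" "x 2 \<noteq> x 3"
    using clockwise_on_circle_inj[OF assms(2)] mem by (auto dest: inj_onD)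
  then show "c' = c"
    using equidistant_point_unique[of "x 1" "x 2" "x 3" c' s c r] r s mem by blast
qed

text \<open>The subset of \<open>k\<close>-dimensional space that is identified with the set of cyclic \<open>k\<close>-gons.\<close>

lemma polygon_params_image:
  assumes k: "k \<ge> 3"
  shows "polygon_params k ` {x. cyclic_polygon k x} =
    {p \<in> extensional {1..k}. p 1 > 0 \<and> (\<forall>i\<in>{2..k}. 0 < p i \<and> p i < 2 * pi) \<and>
       strict_mono_on {2..k} p}" (is "?L = ?R")
proof
  show "?L \<subseteq> ?R"
  proof clarify
    fix x assume "cyclic_polygon k x"
    then obtain c r where x: "clockwise_on_circle k x c r"
      by (auto simp: cyclic_polygon_def)
    have cc: "circumcentre k x = c"
      by (rule circumcentre_eq[OF k x])
    let ?a = "\<lambda>i. clockwise_angle (x 1) c (x i)"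
    have mono: "strict_mono_on {1..k} ?a" and r: "r > 0" "dist c (x 1) = r"
      using x k by (auto simp: clockwise_on_circle_def)
    have pos: "0 < ?a i" if "i \<in> {2..k}" for i
    proof -
      have "?a 1 < ?a i"
        using that by (intro strict_mono_onD[OF mono]) auto
      moreover have "0 \<le> ?a 1"
        by (simp add: clockwise_angle_def Arg2pi_ge_0)
      ultimately show ?thesis by linarith
    qed
    show "polygon_params k x \<in> extensional {1..k} \<and> polygon_params k x 1 > 0 \<and>
       (\<forall>i\<in>{2..k}. 0 < polygon_params k x i \<and> polygon_params k x i < 2 * pi) \<and>
       strict_mono_on {2..k} (polygon_params k x)"
      using r k pos mono
      by (auto simp: polygon_params_def cc strict_mono_on_def clockwise_angle_def Arg2pi_lt_2pi)
  qed
next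
  show "?R \<subseteq> ?L"
  proof clarify
    fix p :: "nat \<Rightarrow> real"
    assume p: "p \<in> extensional {1..k}" "p 1 > 0"
      "\<forall>i\<in>{2..k}. 0 < p i \<and> p i < 2 * pi" "strict_mono_on {2..k} p"
    define \<theta> where "\<theta> i = (if i = 1 then 0 else p i)" for i :: nat
    define x where "x i = of_real (p 1) * cis (- \<theta> i)" for i
    have \<theta>: "0 \<le> \<theta> i" "\<theta> i < 2 * pi" if "i \<in> {1..k}" for i
      using that p(3) by (auto simp: \<theta>_def less_imp_le)
    have ang: "clockwise_angle (x 1) 0 (x i) = \<theta> i" if "i \<in> {1..k}" for i
    proof -
      have "(x 1 - 0) / (x i - 0) = cis (\<theta> i)"
        using p(2) by (simp add: x_def \<theta>_def cis_divide divide_simps flip: cis_inverse)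
      then show ?thesis
        unfolding clockwise_angle_def
        using \<theta>[OF that] by (intro Arg2pi_unique[of 1]) (auto simp: cis_conv_exp)
    qed
    have "strict_mono_on {1..k} \<theta>"
      using p(3,4) by (auto simp: strict_mono_on_def \<theta>_def)
    then have x: "clockwise_on_circle k x 0 (p 1)"
      using p(2) ang by (simp add: clockwise_on_circle_def strict_mono_on_def)
        (simp add: x_def norm_mult)
    then have "cyclic_polygon k x"
      using k by (auto simp: cyclic_polygon_def)
    moreover have "polygon_params k x = p"
    proof
      fix i
      show "polygon_params k x i = p i"
      proof (cases "i \<in> {1..k} \<and> i \<noteq> 1")
        case True
        then show ?thesis
          using ang[of i] by (simp add: polygon_params_def circumcentre_eq[OF k x] \<theta>_def)
      next
        case False
        then show ?thesis
          using p(1,2) by (auto simp: polygon_params_def circumcentre_eq[OF k x] extensional_def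
              x_def norm_mult)
      qed
    qed
    ultimately show "p \<in> ?L" by blast
  qed
qed

text \<open>The parameters determine a cyclic \<open>k\<close>-gon up to a label-preserving isometry.\<close>

lemma polygon_params_eq_imp_congruent:
  assumes "cyclic_polygon k x" "cyclic_polygon k y"
    and eq: "polygon_params k x = polygon_params k y"
    and ij: "i \<in> {1..k}" "j \<in> {1..k}"
  shows "dist (x i) (x j) = dist (y i) (y j)"
proof -
  have dist_eq: "dist (z i) (z j) =
      polygon_params k z 1 * dist (cis (- \<phi> i)) (cis (- \<phi> j))"
    if z: "cyclic_polygon k z" and \<phi>: "\<phi> = (\<lambda>i. if i = 1 then 0 else polygon_params k z i)"
    for z \<phi>
  proof -
    obtain c r where k: "k \<ge> 3" and c: "clockwise_on_circle k z c r"
      using z by (auto simp: cyclic_polygon_def)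
    have cc: "circumcentre k z = c"
      by (rule circumcentre_eq[OF k c])
    have r: "r > 0" "\<And>i. i \<in> {1..k} \<Longrightarrow> dist c (z i) = r"
      using c by (auto simp: clockwise_on_circle_def)
    have pos: "z i = c + (z 1 - c) * cis (- \<phi> i)" if i: "i \<in> {1..k}" for i
    proof (cases "i = 1")
      case True
      then show ?thesis by (simp add: \<phi>)
    next
      case False
      have ne: "z i - c \<noteq> 0" and n: "norm ((z 1 - c) / (z i - c)) = 1"
        using r(1) r(2)[of i] r(2)[of 1] i k
        by (auto simp: norm_divide dist_norm norm_minus_commute)
      have "(z 1 - c) / (z i - c) = cis (\<phi> i)"
        using complex_norm_eq_1_exp[of "(z 1 - c) / (z i - c)"] n i False
        by (simp add: \<phi> polygon_params_def cc clockwise_angle_def cis_conv_exp)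
      then have "z 1 - c = cis (\<phi> i) * (z i - c)"
        using ne by (simp add: divide_eq_eq)
      then have "(z 1 - c) * cis (- \<phi> i) = (z i - c) * (cis (\<phi> i) * cis (- \<phi> i))"
        by (simp add: mult_ac)
      then show ?thesis by (simp add: cis_mult)
    qed
    have "z i - z j = (z 1 - c) * (cis (- \<phi> i) - cis (- \<phi> j))"
      using pos[OF ij(1)] pos[OF ij(2)] by (metis add_diff_cancel_left right_diff_distrib)
    moreover have "norm (z 1 - c) = polygon_params k z 1"
      using k by (simp add: polygon_params_def cc dist_norm norm_minus_commute)
    ultimately show ?thesis by (simp add: dist_norm norm_mult)
  qed
  show ?thesis
    using dist_eq[OF assms(1) refl] dist_eq[OF assms(2) refl] by (simp add: eq)
qed

end

theory Submission
  imports Defs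
begin

text \<open>
  Let the vertices \<open>x i\<close> of a cyclic polygon with angles \<open>\<theta> i\<close> sit in a transitive set
  \<open>{z 0, \<dots>, z (N - 1)}\<close>, and let a symmetry take \<open>x 1\<close> to \<open>x i\<close>; it permutes the \<open>z m\<close>. The vector
  of squared distances from \<open>x i\<close> to the \<open>z m\<close> has the form \<open>c + cos (\<theta> i) u + sin (\<theta> i) v\<close> and
  arises from the vector of \<open>x 1\<close> by this permutation of coordinates. There are only countably many
  tuples of permutations. If two polygons with angles \<open>\<theta>\<close>, \<open>\<theta>'\<close> belong to the same tuple, the inner
  product of the vectors of \<open>x i\<close> and \<open>x' i\<close> does not depend on \<open>i\<close>. Suppose that \<open>\<theta>' - \<theta>\<close> is \<open>0\<close> at
  five indices, \<open>h\<close> at five others and \<open>- h\<close> at one more. The first five say that a trigonometric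
  polynomial of degree two is constant, which makes the symmetric part of the \<open>3 \<times> 3\<close> matrix of inner
  products of \<open>c, u, v\<close> with \<open>c', u', v'\<close> diagonal; the others then force \<open>u \<bullet> u' = 0\<close>. As \<open>u\<close> can
  be normalised and bounded, every line in a fixed direction meets the closed set of angles belonging
  to one tuple and one bound in boundedly many points, so this set is null.
\<close>

section \<open>Trigonometric polynomials and bilinear forms on the circle\<close>

text \<open>With \<open>z = cis a\<close>, twice the expression times \<open>z^2\<close> is a
  complex polynomial in \<open>z\<close> of degree at most four, so five distinct roots force all
  coefficients to vanish.\<close>

lemma trig_polynomial_eq_0:
  fixes A B C D E :: real
  assumes S: "5 \<le> card S" "inj_on cis S"
    and 0: "\<And>a. a \<in> S \<Longrightarrow> A + B * cos a + C * sin a + D * cos (2 * a) + E * sin (2 * a) = 0"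
  shows "A = 0 \<and> B = 0 \<and> C = 0 \<and> D = 0 \<and> E = 0"
proof -
  define p where "p = [: Complex D E, Complex B C, Complex (2 * A) 0, Complex B (- C), Complex D (- E) :]"
  have root: "poly p (cis a) = 0" if "a \<in> S" for a
  proof -
    have "poly p (cis a) = (cis a)^2 * of_real (2 * (A + B * cos a + C * sin a + D * cos (2 * a) + E * sin (2 * a)))"
    proof -
      define x y where "x = cos a" and "y = sin a"
      have y2: "y * y = 1 - x * x"
        using sin_cos_squared_add[of a] by (simp add: x_def y_def power2_eq_square algebra_simps)
      have c: "cis a = Complex x y" by (simp add: cis.code x_def y_def)
      have d: "cos (2 * a) = x * x - y * y" "sin (2 * a) = 2 * y * x"
        by (simp_all add: cos_double sin_double x_def y_def power2_eq_square)
      show ?thesis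
        unfolding p_def c d x_def[symmetric] y_def[symmetric]
        apply (simp add: complex_eq_iff power2_eq_square)
        using y2 by algebra
    qed
    then show ?thesis using 0[OF that] by simp
  qed
  have "p = 0"
  proof (rule ccontr)
    assume "p \<noteq> 0"
    have "cis ` S \<subseteq> {z. poly p z = 0}" using root by auto
    then have "card (cis ` S) \<le> card {z. poly p z = 0}"
      by (intro card_mono poly_roots_finite) (use \<open>p \<noteq> 0\<close> in auto)
    also have "\<dots> \<le> degree p" by (rule card_poly_roots_bound) fact
    also have "\<dots> \<le> 4" by (simp add: p_def)
    finally show False using S by (simp add: card_image)
  qed
  then show ?thesis by (auto simp: p_def complex_eq_iff)
qed

text \<open>\<open>F\<close> is a bilinear form in the vectors \<open>(1, cos, sin)\<close> of two
  angles. The diagonal sees only the symmetric part of its matrix; five diagonal values leave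
  \<open>F x y - \<kappa> = p11 * (cos (y - x) - 1) + p12 * sin (y - x) + p01 * (cos y - cos x) +
  p02 * (sin y - sin x)\<close>. The shifts by \<open>h\<close> remove \<open>p01\<close> and
  \<open>p02\<close> and relate \<open>p11\<close> to \<open>p12\<close>; the shift by
  \<open>- h\<close> gives the same relation with the sign of \<open>p11\<close> reversed.\<close>

lemma cross_form_zero:
  fixes p00 p01 p02 p10 p11 p12 p20 p21 p22 \<kappa> h b :: real
  defines "F \<equiv> \<lambda>x y. p00 + p01 * cos y + p02 * sin y
                   + cos x * (p10 + p11 * cos y + p12 * sin y)
                   + sin x * (p20 + p21 * cos y + p22 * sin y)"
  assumes S1: "5 \<le> card S1" "inj_on cis S1" "\<And>a. a \<in> S1 \<Longrightarrow> F a a = \<kappa>"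
    and S2: "5 \<le> card S2" "inj_on cis S2" "\<And>a. a \<in> S2 \<Longrightarrow> F a (a + h) = \<kappa>"
    and b: "F b (b - h) = \<kappa>" and h: "sin (h / 2) \<noteq> 0"
  shows "p11 = 0"
proof -
  have "(p00 + (p11 + p22) / 2 - \<kappa>) = 0 \<and> p01 + p10 = 0 \<and> p02 + p20 = 0 \<and> (p11 - p22) / 2 = 0
     \<and> (p12 + p21) / 2 = 0"
  proof (rule trig_polynomial_eq_0[OF S1(1,2)])
    fix a assume "a \<in> S1"
    have c: "cos a * cos a = (1 + cos (2 * a)) / 2" "sin a * sin a = (1 - cos (2 * a)) / 2"
      "cos a * sin a = sin (2 * a) / 2"
    proof -
      show "cos a * cos a = (1 + cos (2 * a)) / 2"
        unfolding cos_double_cos power2_eq_square by simp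
      show "sin a * sin a = (1 - cos (2 * a)) / 2"
        unfolding cos_double_sin power2_eq_square by simp
      show "cos a * sin a = sin (2 * a) / 2"
        unfolding sin_double by simp
    qed
    have "F a a = p00 + (p01 + p10) * cos a + (p02 + p20) * sin a + p11 * (cos a * cos a)
        + (p12 + p21) * (cos a * sin a) + p22 * (sin a * sin a)"
      by (simp add: F_def algebra_simps)
    then show "p00 + (p11 + p22) / 2 - \<kappa> + (p01 + p10) * cos a + (p02 + p20) * sin a +
         (p11 - p22) / 2 * cos (2 * a) + (p12 + p21) / 2 * sin (2 * a) = 0"
      using S1(3)[OF \<open>a \<in> S1\<close>] unfolding c by (simp add: field_simps)
  qed
  then have rel: "p10 = - p01" "p20 = - p02" "p22 = p11" "p21 = - p12" "p00 = \<kappa> - p11"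
    by auto
  \<comment> \<open>The chord from the angle \<open>m - t\<close> to \<open>m + t\<close> is \<open>2 sin t\<close> times the unit tangent at its midpoint \<open>m\<close>.\<close>
  have chord: "F (m - t) (m + t) - \<kappa> = 2 * sin t * (p12 * cos t - p11 * sin t - p01 * sin m + p02 * cos m)"
    for m t
  proof -
    define x y X Y where d: "x = cos m" "y = sin m" "X = cos t" "Y = sin t"
    have s: "x * x = 1 - y * y" "X * X = 1 - Y * Y"
      using sin_cos_squared_add[of m] sin_cos_squared_add[of t]
      by (simp_all add: d power2_eq_square algebra_simps)
    show ?thesis
      unfolding F_def rel cos_add cos_diff sin_add sin_diff d[symmetric]
      using s by algebra
  qed
  have lin: "p12 * cos t - p11 * sin t - p01 * sin m + p02 * cos m = 0"
    if "F (m - t) (m + t) = \<kappa>" "sin t \<noteq> 0" for m t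
    using chord[of m t] that by simp
  \<comment> \<open>As a function of the midpoint \<open>m\<close> the second factor of the chord
    formula has degree one, so five midpoints make its three coefficients vanish.\<close>
  have "(p12 * cos (h / 2) - p11 * sin (h / 2) = 0) \<and> p02 = 0 \<and> - p01 = 0 \<and> (0::real) = 0 \<and> (0::real) = 0"
  proof (rule trig_polynomial_eq_0)
    show "5 \<le> card ((\<lambda>a. a + h / 2) ` S2)"
      using S2(1) by (simp add: card_image)
    show "inj_on cis ((\<lambda>a. a + h / 2) ` S2)"
      using S2(2) by (auto simp: inj_on_def simp flip: cis_mult)
    fix m assume "m \<in> (\<lambda>a. a + h / 2) ` S2"
    then obtain a where "a \<in> S2" "m = a + h / 2" by blast
    then have "F (m - h / 2) (m + h / 2) = \<kappa>" using S2(3)[of a] by (simp add: add.commute)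
    from lin[OF this h] show "p12 * cos (h / 2) - p11 * sin (h / 2) + p02 * cos m + - p01 * sin m +
         0 * cos (2 * m) + 0 * sin (2 * m) = 0" by simp
  qed
  \<comment> \<open>Taking \<open>t = - (h / 2)\<close> reverses the sine but not the cosine, so the
    difference of the two relations is \<open>2 * p11 * sin (h / 2) = 0\<close>.\<close>
  moreover have "F (b - h / 2 - - (h / 2)) (b - h / 2 + - (h / 2)) = \<kappa>" using b by simp
  from lin[OF this] h have "p12 * cos (h / 2) + p11 * sin (h / 2) - p01 * sin (b - h / 2) + p02 * cos (b - h / 2) = 0"
    by simp
  ultimately show ?thesis using h by simp
qed

text \<open>The squared norm of the sum of all \<open>u t\<close> is estimated in two ways:
  coordinate \<open>m0\<close> alone contributes \<open>(card F)^2\<close>, while by orthogonality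
  the total is the sum of the squared norms, each at most \<open>N * K^2\<close>.\<close>

lemma card_pairwise_orthogonal_le:
  fixes u :: "'a \<Rightarrow> nat \<Rightarrow> real"
  assumes "finite F" and orth: "\<And>s t. s \<in> F \<Longrightarrow> t \<in> F \<Longrightarrow> s \<noteq> t \<Longrightarrow> (\<Sum>m<N. u s m * u t m) = 0"
    and m0: "m0 < N" "\<And>t. t \<in> F \<Longrightarrow> u t m0 = 1"
    and K: "\<And>t m. t \<in> F \<Longrightarrow> m < N \<Longrightarrow> \<bar>u t m\<bar> \<le> real K"
  shows "card F \<le> N * K\<^sup>2"
proof (cases "F = {}")
  case False
  have "(real (card F))\<^sup>2 = (\<Sum>t\<in>F. u t m0)\<^sup>2" using m0 by simp
  also have "\<dots> \<le> (\<Sum>m<N. (\<Sum>t\<in>F. u t m)\<^sup>2)"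
    by (rule member_le_sum) (use m0 in auto)
  also have "\<dots> = (\<Sum>m<N. \<Sum>s\<in>F. \<Sum>t\<in>F. u s m * u t m)"
    by (simp add: power2_eq_square sum_product)
  also have "\<dots> = (\<Sum>s\<in>F. \<Sum>t\<in>F. \<Sum>m<N. u s m * u t m)"
    by (simp add: sum.swap[of _ _ "{..<N}"])
  also have "\<dots> = (\<Sum>s\<in>F. \<Sum>m<N. u s m * u s m)"
  proof (rule sum.cong[OF refl])
    fix s assume "s \<in> F"
    then have "(\<Sum>t\<in>F. \<Sum>m<N. u s m * u t m) = (\<Sum>t\<in>F. if t = s then \<Sum>m<N. u s m * u s m else 0)"
      using orth by (intro sum.cong) auto
    then show "(\<Sum>t\<in>F. \<Sum>m<N. u s m * u t m) = (\<Sum>m<N. u s m * u s m)"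
      using \<open>s \<in> F\<close> \<open>finite F\<close> by simp
  qed
  also have "\<dots> \<le> (\<Sum>s\<in>F. \<Sum>m<N. (real K)\<^sup>2)"
    by (intro sum_mono) (metis K abs_ge_zero abs_le_square_iff abs_of_nat lessThan_iff power2_eq_square)
  finally have "(real (card F))\<^sup>2 \<le> real (card F) * real (N * K\<^sup>2)" by simp
  moreover have "card F > 0" using False \<open>finite F\<close> by (simp add: card_gt_0_iff)
  ultimately have "real (card F) \<le> real (N * K\<^sup>2)" by (simp add: power2_eq_square)
  then show ?thesis by linarith
qed simp

section \<open>Closed projections and null sets of product measures\<close>

text \<open>Projection along a compact factor is a closed map: by the tube lemma, a slice
  \<open>{x} \<times> B\<close> that misses \<open>E\<close> has a neighbourhood
  \<open>U \<times> B\<close> that misses \<open>E\<close>.\<close>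

lemma closed_compact_fibre:
  fixes B :: "'b::topological_space set" and E :: "('a::topological_space \<times> 'b) set"
  assumes "compact B" "closed E"
  shows "closed {x. \<exists>y\<in>B. (x, y) \<in> E}"
proof -
  have "open (- {x. \<exists>y\<in>B. (x, y) \<in> E})"
  proof (rule Topological_Spaces.openI)
    fix x assume "x \<in> - {x. \<exists>y\<in>B. (x, y) \<in> E}"
    then have sub: "{x} \<times> B \<subseteq> - E" by auto
    have "open (- E)" using \<open>closed E\<close> by (rule open_Compl)
    from Elementary_Topology.tube_lemma[OF \<open>compact B\<close> this sub]
    obtain U where "x \<in> U" "open U" "U \<times> B \<subseteq> - E" by blast
    then show "\<exists>U. open U \<and> x \<in> U \<and> U \<subseteq> - {x. \<exists>y\<in>B. (x, y) \<in> E}" by blast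
  qed
  then show ?thesis by (simp add: closed_def)
qed

text \<open>Boxes determine the product measure, and on boxes the claim is translation invariance of
  \<open>lborel\<close> in each coordinate.\<close>

lemma distr_translate_PiM_lborel:
  fixes a :: "'i \<Rightarrow> real"
  assumes "finite I"
  shows "distr (\<Pi>\<^sub>M i\<in>I. lborel) (\<Pi>\<^sub>M i\<in>I. lborel) (\<lambda>x. \<lambda>i\<in>I. x i + a i) = (\<Pi>\<^sub>M i\<in>I. lborel)"
proof -
  interpret product_sigma_finite "\<lambda>_::'i. lborel :: real measure" by standard
  let ?M = "\<Pi>\<^sub>M i\<in>I. (lborel :: real measure)"
  have meas [measurable]: "(\<lambda>x. \<lambda>i\<in>I. x i + a i) \<in> ?M \<rightarrow>\<^sub>M ?M" by measurable
  show ?thesis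
  proof (rule PiM_eqI[OF assms])
    fix A :: "'i \<Rightarrow> real set" assume A: "\<And>i. i \<in> I \<Longrightarrow> A i \<in> sets lborel"
    have "(\<lambda>x. \<lambda>i\<in>I. x i + a i) -` Pi\<^sub>E I A \<inter> space ?M = Pi\<^sub>E I (\<lambda>i. (\<lambda>x. x + a i) -` A i)"
      by (auto simp: space_PiM PiE_iff)
    moreover have "(\<lambda>x. x + a i) -` A i \<in> sets lborel" if "i \<in> I" for i
      using measurable_sets[of "\<lambda>x::real. x + a i" borel borel "A i"] A[OF that] by simp
    moreover have "emeasure lborel ((\<lambda>x. x + a i) -` A i) = emeasure lborel (A i)" if "i \<in> I" for i
    proof -
      have "emeasure lborel (A i) = emeasure (distr lborel borel ((+) (a i))) (A i)"
        using lborel_distr_plus[of "a i"] by simp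
      also have "\<dots> = emeasure lborel ((\<lambda>x. x + a i) -` A i)"
        using A[OF that] by (subst emeasure_distr) (auto simp: add.commute[of _ "a i"])
      finally show ?thesis by simp
    qed
    moreover have "Pi\<^sub>E I A \<in> sets ?M" using A assms by (intro sets_PiM_I_finite) auto
    ultimately show "emeasure (distr ?M ?M (\<lambda>x. \<lambda>i\<in>I. x i + a i)) (Pi\<^sub>E I A) = (\<Prod>i\<in>I. emeasure lborel (A i))"
      using assms by (simp add: emeasure_distr emeasure_PiM)
  qed simp
qed

text \<open>Many small translates of \<open>A\<close> along \<open>w\<close> fit into a fixed box, and no point lies in
  more than \<open>B\<close> of them.\<close>

lemma null_set_if_few_points_on_lines:
  fixes w :: "'i \<Rightarrow> real" and B :: nat
  assumes "finite I" and A: "A \<in> sets (\<Pi>\<^sub>M i\<in>I. lborel)" "A \<subseteq> Pi\<^sub>E I (\<lambda>_. {- R..R})"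
    and w: "\<And>i. i \<in> I \<Longrightarrow> \<bar>w i\<bar> \<le> 1"
    and few: "\<And>x T. finite T \<Longrightarrow> (\<And>t. t \<in> T \<Longrightarrow> (\<lambda>i\<in>I. x i + t * w i) \<in> A) \<Longrightarrow> card T \<le> B"
  shows "A \<in> null_sets (\<Pi>\<^sub>M i\<in>I. lborel)"
proof -
  interpret product_sigma_finite "\<lambda>_::'i. lborel :: real measure" by standard
  let ?M = "\<Pi>\<^sub>M i\<in>I. (lborel :: real measure)"
  define \<tau> where "\<tau> t = (\<lambda>x. \<lambda>i\<in>I. x i + t * w i)" for t
  define Q where "Q = Pi\<^sub>E I (\<lambda>_::'i. {- (R + 1)..R + 1})"
  have [measurable]: "\<tau> t \<in> ?M \<rightarrow>\<^sub>M ?M" for t unfolding \<tau>_def by measurable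
  have Q: "Q \<in> sets ?M" unfolding Q_def using assms(1) by (intro sets_PiM_I_finite) auto
  have finQ: "emeasure ?M Q < \<infinity>"
    unfolding Q_def using assms(1)
    by (subst emeasure_PiM) (auto simp: emeasure_lborel_Icc_eq power_less_top_ennreal)
  define P where "P t = \<tau> t -` A \<inter> space ?M" for t
  have P: "P t \<in> sets ?M" for t unfolding P_def by (rule measurable_sets[OF _ A(1)]) measurable
  have eP: "emeasure ?M (P t) = emeasure ?M A" for t
  proof -
    have "emeasure ?M A = emeasure (distr ?M ?M (\<tau> t)) A"
      unfolding \<tau>_def distr_translate_PiM_lborel[OF assms(1)] ..
    also have "\<dots> = emeasure ?M (P t)"
      unfolding P_def by (rule emeasure_distr) (use A(1) in auto)
    finally show ?thesis ..
  qed
  \<comment> \<open>Infinitely many distinct parameters in the unit interval: the corresponding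
    shifts along \<open>w\<close> move no coordinate by more than one, so all translates stay in
    \<open>Q\<close>.\<close>
  define s where "s j = 1 / real (Suc j)" for j
  have s: "0 \<le> s j" "s j \<le> 1" for j by (auto simp: s_def)
  have inj: "inj s" by (auto simp: inj_def s_def)
  have PQ: "P (s j) \<subseteq> Q" for j
  proof
    fix x assume x: "x \<in> P (s j)"
    have "x i \<in> {- (R + 1)..R + 1}" if i: "i \<in> I" for i
    proof -
      have "x i + s j * w i \<in> {- R..R}"
        using x i A(2) by (auto simp: P_def \<tau>_def PiE_iff subset_iff) 
      moreover have "\<bar>s j * w i\<bar> \<le> 1"
        using s[of j] w[OF i] by (simp add: abs_mult mult_le_one)
      ultimately show ?thesis by auto
    qed
    then show "x \<in> Q" using x by (auto simp: P_def Q_def space_PiM PiE_iff)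
  qed
  \<comment> \<open>Integrate the number of the first \<open>n\<close> translates that contain
    \<open>x\<close>: it is at most \<open>B\<close> everywhere and zero off
    \<open>Q\<close>.\<close>
  have bound: "of_nat n * emeasure ?M A \<le> of_nat B * emeasure ?M Q" for n
  proof -
    have "of_nat n * emeasure ?M A = (\<Sum>j<n. emeasure ?M (P (s j)))" by (simp add: eP)
    also have "\<dots> = (\<Sum>j<n. \<integral>\<^sup>+ x. indicator (P (s j)) x \<partial>?M)"
      using P by (simp add: nn_integral_indicator)
    also have "\<dots> = (\<integral>\<^sup>+ x. (\<Sum>j<n. indicator (P (s j)) x) \<partial>?M)"
      using P by (intro nn_integral_sum[symmetric]) auto
    also have "\<dots> \<le> (\<integral>\<^sup>+ x. of_nat B * indicator Q x \<partial>?M)"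
    proof (rule nn_integral_mono)
      fix x assume "x \<in> space ?M"
      have "(\<Sum>j<n. indicator (P (s j)) x :: ennreal) = of_nat (card {j. j < n \<and> x \<in> P (s j)})"
        by (simp add: indicator_def sum.If_cases Int_def flip: lessThan_def)
      also have "card {j. j < n \<and> x \<in> P (s j)} = card (s ` {j. j < n \<and> x \<in> P (s j)})"
        using inj by (simp add: card_image inj_on_subset)
      also have "\<dots> \<le> B"
        by (rule few[where x = x]) (auto simp: P_def \<tau>_def)
      finally have le: "(\<Sum>j<n. indicator (P (s j)) x :: ennreal) \<le> of_nat B" by simp
      show "(\<Sum>j<n. indicator (P (s j)) x :: ennreal) \<le> of_nat B * indicator Q x"
      proof (cases "x \<in> Q")
        case True with le show ?thesis by simp
      next
        case False
        then have "x \<notin> P (s j)" for j using PQ by auto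
        then show ?thesis by simp
      qed
    qed
    also have "\<dots> = of_nat B * emeasure ?M Q" using Q by (simp add: nn_integral_cmult_indicator)
    finally show ?thesis .
  qed
  have "emeasure ?M A = 0"
  proof (rule ccontr)
    assume "emeasure ?M A \<noteq> 0"
    have "of_nat B * emeasure ?M Q < top" using finQ by (simp add: ennreal_mult_less_top of_nat_less_top)
    then obtain c where c: "of_nat B * emeasure ?M Q = ennreal c" "0 \<le> c"
      by (metis ennreal_cases less_irrefl)
    have "emeasure ?M A \<le> ennreal c" using bound[of 1] c by simp
    then have "emeasure ?M A < top" by (rule le_less_trans) simp
    then obtain a where a: "emeasure ?M A = ennreal a" "0 \<le> a"
      by (metis ennreal_cases less_irrefl)
    then have "a > 0" using \<open>emeasure ?M A \<noteq> 0\<close> by (cases "a = 0") auto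
    have "real n * a \<le> c" for n
      using bound[of n] a c by (simp add: ennreal_of_nat_eq_real_of_nat flip: ennreal_mult)
    then show False using \<open>a > 0\<close> by (metis linorder_not_less reals_Archimedean3)
  qed
  then show ?thesis using A(1) by auto
qed

section \<open>Angles belonging to fixed permutations form a null set\<close>

text \<open>Up to a constant factor, coordinate \<open>m\<close> of \<open>c + cos (\<theta> i) u + sin (\<theta> i) v\<close> is the squared
  distance from the \<open>i\<close>-th vertex to the \<open>m\<close>-th point of the transitive set, and \<open>\<rho> i\<close> is the
  inverse of the permutation induced by a symmetry taking vertex \<open>1\<close>, of angle \<open>0\<close>, to vertex \<open>i\<close>.
  The bound \<open>K\<close> makes this a closed condition on \<open>\<theta>\<close>.\<close>

definition orbit_angles :: "nat \<Rightarrow> nat \<Rightarrow> (nat \<Rightarrow> nat \<Rightarrow> nat) \<Rightarrow> nat \<Rightarrow> nat \<Rightarrow> (nat \<Rightarrow> real) set" where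
  "orbit_angles k N \<rho> m0 K = {\<theta>. \<exists>c u v.
     (\<forall>m. \<bar>c m\<bar> \<le> real K \<and> \<bar>u m\<bar> \<le> real K \<and> \<bar>v m\<bar> \<le> real K) \<and> u m0 = 1 \<and>
     (\<forall>i\<in>{2..k}. \<forall>m<N. c (\<rho> i m) + u (\<rho> i m) = c m + cos (\<theta> i) * u m + sin (\<theta> i) * v m)}"

text \<open>The bounded triples \<open>(c, u, v)\<close> form a compact set by Tychonoff, as the
  bound is imposed at every index \<open>m\<close>. The equations are jointly continuous in
  \<open>\<theta>\<close>, \<open>c\<close>, \<open>u\<close>, \<open>v\<close>, and projecting the
  compact factor away keeps the set closed.\<close>

lemma closed_orbit_angles: "closed (orbit_angles k N \<rho> m0 K)"
proof -
  define B :: "(nat \<Rightarrow> real) set" where "B = Pi\<^sub>E UNIV (\<lambda>_. {- real K..real K})"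
  define E :: "((nat \<Rightarrow> real) \<times> (nat \<Rightarrow> real) \<times> (nat \<Rightarrow> real) \<times> (nat \<Rightarrow> real)) set" where
    "E = {z. fst (snd (snd z)) m0 = 1 \<and>
      (\<forall>i m. i \<in> {2..k} \<and> m < N \<longrightarrow> fst (snd z) (\<rho> i m) + fst (snd (snd z)) (\<rho> i m) =
         fst (snd z) m + cos (fst z i) * fst (snd (snd z)) m + sin (fst z i) * snd (snd (snd z)) m)}"
  have "compactin (powertop_real UNIV) B"
    unfolding B_def by (simp add: compactin_PiE)
  then have "compact B" by (simp add: euclidean_product_topology)
  then have "compact (B \<times> B \<times> B)" by (intro compact_Times)
  moreover have "closed E"
    unfolding E_def
    by (intro closed_Collect_conj closed_Collect_all closed_Collect_imp closed_Collect_eq open_Collect_const continuous_intros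
        continuous_on_product_then_coordinatewise)
  ultimately have "closed {\<theta>. \<exists>y\<in>B \<times> B \<times> B. (\<theta>, y) \<in> E}" by (rule closed_compact_fibre)
  moreover have "(\<exists>y\<in>B \<times> B \<times> B. (\<theta>, y) \<in> E) \<longleftrightarrow> \<theta> \<in> orbit_angles k N \<rho> m0 K" for \<theta>
  proof -
    have mem: "b \<in> B \<longleftrightarrow> (\<forall>m. \<bar>b m\<bar> \<le> real K)" for b
      by (auto simp: B_def PiE_UNIV_domain abs_le_iff minus_le_iff)
    have "(\<exists>y\<in>B \<times> B \<times> B. (\<theta>, y) \<in> E) \<longleftrightarrow> (\<exists>c u v. c \<in> B \<and> u \<in> B \<and> v \<in> B \<and> (\<theta>, c, u, v) \<in> E)"
      by auto
    also have "\<dots> \<longleftrightarrow> \<theta> \<in> orbit_angles k N \<rho> m0 K"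
      unfolding orbit_angles_def mem E_def mem_Collect_eq by (intro ex_cong1) auto
    finally show ?thesis .
  qed
  ultimately show ?thesis by simp
qed

definition angle_domain :: "nat \<Rightarrow> (nat \<Rightarrow> real) set" where
  "angle_domain k = {\<theta>. (\<forall>i\<in>{2..k}. 0 < \<theta> i \<and> \<theta> i < 2 * pi) \<and> strict_mono_on {2..k} \<theta>}"

text \<open>The common direction of the lines: indices 2 to 6 stay fixed, 7 to 11 move forward and
  12 moves back, which supplies the sets \<open>S1\<close>, \<open>S2\<close> and the point
  \<open>b\<close> of \<open>cross_form_zero\<close>. The circumradius at index 1 is fixed as
  well.\<close>

definition shear :: "nat \<Rightarrow> real" where
  "shear i = (if i \<in> {7..11} then 1 else if i = 12 then - 1 else 0)"

lemma inj_on_cis: "inj_on cis {0..<2 * pi}"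
proof (rule inj_on_inverseI)
  fix a assume "a \<in> {0..<2 * pi}"
  then show "Arg2pi (cis a) = a"
    by (intro Arg2pi_unique[of 1]) (auto simp: cis_conv_exp)
qed

text \<open>Two points of one line share the permutations \<open>\<rho>\<close>, so
  \<open>cross_form_zero\<close> makes their vectors \<open>u\<close> orthogonal. Since these
  vectors are bounded and equal 1 at \<open>m0\<close>, there are few of them.\<close>

lemma orbit_angles_card_le:
  fixes T :: "real set"
  assumes k: "12 \<le> k" and "m0 < N" "finite T"
    and bij: "\<And>i. i \<in> {2..k} \<Longrightarrow> bij_betw (\<rho> i) {..<N} {..<N}"
    and T: "\<And>t. t \<in> T \<Longrightarrow> (\<lambda>i\<in>{1..k}. x i + t * shear i) \<in> orbit_angles k N \<rho> m0 K \<inter> angle_domain k"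
  shows "card T \<le> N * K\<^sup>2"
proof -
  define a where "a t i = x i + t * shear i" for t i
  have "\<exists>c u v. (\<forall>m. \<bar>u m\<bar> \<le> real K) \<and> u m0 = 1 \<and>
      (\<forall>i\<in>{2..k}. \<forall>m<N. c (\<rho> i m) + u (\<rho> i m) = c m + cos (a t i) * u m + sin (a t i) * v m)"
    if "t \<in> T" for t
  proof -
    have "(\<lambda>i\<in>{1..k}. x i + t * shear i) i = a t i" if "i \<in> {2..k}" for i
      using that by (simp add: a_def)
    then show ?thesis using T[OF that] unfolding orbit_angles_def by (auto simp: a_def)
  qed
  then obtain c u v where bounded: "\<And>t m. t \<in> T \<Longrightarrow> \<bar>u t m\<bar> \<le> real K"
    and m0: "\<And>t. t \<in> T \<Longrightarrow> u t m0 = 1"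
    and rel: "\<And>t i m. t \<in> T \<Longrightarrow> i \<in> {2..k} \<Longrightarrow> m < N \<Longrightarrow>
      c t (\<rho> i m) + u t (\<rho> i m) = c t m + cos (a t i) * u t m + sin (a t i) * v t m"
    by metis
  have range: "0 < a t i" "a t i < 2 * pi" if "t \<in> T" "i \<in> {2..k}" for t i
    using T[OF that(1)] that(2) by (auto simp: angle_domain_def a_def)
  have mono: "strict_mono_on {2..k} (a t)" if "t \<in> T" for t
    using T[OF that] by (auto simp: angle_domain_def a_def strict_mono_on_def)
  have image: "5 \<le> card (a t ` {l..l + 4})" "inj_on cis (a t ` {l..l + 4})"
    if "t \<in> T" "2 \<le> l" "l + 4 \<le> k" for t l
  proof -
    have sub: "{l..l + 4} \<subseteq> {2..k}" using that by auto
    have "inj_on (a t) {l..l + 4}"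
      using strict_mono_on_imp_inj_on[OF mono[OF that(1)]] sub by (rule inj_on_subset)
    then show "5 \<le> card (a t ` {l..l + 4})" by (simp add: card_image)
    have "a t ` {l..l + 4} \<subseteq> {0..<2 * pi}"
      using range[OF that(1)] sub by (force simp: less_imp_le)
    then show "inj_on cis (a t ` {l..l + 4})" by (rule inj_on_subset[OF inj_on_cis])
  qed
  show ?thesis
  proof (rule card_pairwise_orthogonal_le[where u = u and ?m0.0 = m0])
    fix s t assume st: "s \<in> T" "t \<in> T" "s \<noteq> t"
    define \<kappa> where "\<kappa> = (\<Sum>m<N. (c s m + u s m) * (c t m + u t m))"
    let ?F = "\<lambda>y z. (\<Sum>m<N. c s m * c t m) + (\<Sum>m<N. c s m * u t m) * cos z + (\<Sum>m<N. c s m * v t m) * sin z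
      + cos y * ((\<Sum>m<N. u s m * c t m) + (\<Sum>m<N. u s m * u t m) * cos z + (\<Sum>m<N. u s m * v t m) * sin z)
      + sin y * ((\<Sum>m<N. v s m * c t m) + (\<Sum>m<N. v s m * u t m) * cos z + (\<Sum>m<N. v s m * v t m) * sin z)"
    \<comment> \<open>The same permutation \<open>\<rho> i\<close> reindexes the vectors of both
      polygons, so their inner product is that of the first vertices.\<close>
    have F: "?F (a s i) (a t i) = \<kappa>" if i: "i \<in> {2..k}" for i
    proof -
      have "\<kappa> = (\<Sum>m<N. (c s (\<rho> i m) + u s (\<rho> i m)) * (c t (\<rho> i m) + u t (\<rho> i m)))"
        unfolding \<kappa>_def by (rule sum.reindex_bij_betw[OF bij[OF i], symmetric])
      also have "\<dots> = (\<Sum>m<N. (c s m + cos (a s i) * u s m + sin (a s i) * v s m)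
          * (c t m + cos (a t i) * u t m + sin (a t i) * v t m))"
        using rel[OF st(1) i] rel[OF st(2) i] by simp
      also have "\<dots> = ?F (a s i) (a t i)"
        by (simp add: algebra_simps sum.distrib sum_distrib_left)
      finally show ?thesis by simp
    qed
    have a_t: "a t i = a s i + (t - s) * shear i" for i by (simp add: a_def algebra_simps)
    show "(\<Sum>m<N. u s m * u t m) = 0"
    proof (rule cross_form_zero)
      show "5 \<le> card (a s ` {2..2+4})" "inj_on cis (a s ` {2..2+4})"
        "5 \<le> card (a s ` {7..7+4})" "inj_on cis (a s ` {7..7+4})"
        using image[OF st(1), of 2] image[OF st(1), of 7] k by simp_all
      show "?F y y = \<kappa>" if "y \<in> a s ` {2..2+4}" for y
      proof -
        from that obtain i where "i \<in> {2..6}" "y = a s i" by auto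
        then show ?thesis using F[of i] k by (simp add: a_t shear_def)
      qed
      show "?F y (y + (t - s)) = \<kappa>" if "y \<in> a s ` {7..7+4}" for y
      proof -
        from that obtain i where "i \<in> {7..11}" "y = a s i" by auto
        then show ?thesis using F[of i] k by (simp add: a_t shear_def)
      qed
      have "a t 12 = a s 12 - (t - s)" by (simp add: a_t shear_def)
      then show "?F (a s 12) (a s 12 - (t - s)) = \<kappa>"
        using F[of 12] k by simp
      \<comment> \<open>The two angles at index 7 both lie strictly between \<open>0\<close> and
        \<open>2 * pi\<close> and differ by \<open>t - s\<close>.\<close>
      have "\<bar>t - s\<bar> < 2 * pi"
        using range[OF st(1), of 7] range[OF st(2), of 7] k unfolding a_t[of 7]
        by (auto simp: shear_def)
      then have "- pi < (t - s) / 2" "(t - s) / 2 < pi" by (simp_all add: abs_less_iff)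
      then show "sin ((t - s) / 2) \<noteq> 0"
        using sin_eq_0_pi[of "(t - s) / 2"] st(3) by auto
    qed
  qed (use assms bounded m0 in auto)
qed

text \<open>Lines in direction \<open>shear\<close> meet the set in at most \<open>N * K^2\<close>
  points. The measure argument asks for a bounded set, so the set is exhausted by its intersections
  \<open>S R\<close> with cubes.\<close>

lemma null_sets_orbit_angles:
  assumes k: "12 \<le> k" and "m0 < N" and bij: "\<And>i. i \<in> {2..k} \<Longrightarrow> bij_betw (\<rho> i) {..<N} {..<N}"
  shows "{p \<in> extensional {1..k}. p \<in> orbit_angles k N \<rho> m0 K \<and> p \<in> angle_domain k}
    \<in> null_sets (\<Pi>\<^sub>M i\<in>{1..k}. lborel)"
proof -
  let ?M = "\<Pi>\<^sub>M i\<in>{1..k}. (lborel :: real measure)"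
  \<comment> \<open>On the space of \<open>?M\<close> a coordinate outside \<open>{1..k}\<close> is
    constantly \<open>undefined\<close>. With all coordinates measurable, so is the identity into
    the full function space, and closed sets there have measurable traces.\<close>
  have comp: "(\<lambda>p. p i) \<in> borel_measurable ?M" for i
  proof (cases "i \<in> {1..k}")
    case True
    then show ?thesis using measurable_component_singleton[of i "{1..k}" "\<lambda>_. lborel :: real measure"] by simp
  next
    case False
    then have "p i = undefined" if "p \<in> space ?M" for p
      using that by (auto simp: space_PiM PiE_iff extensional_def)
    then show ?thesis by (subst measurable_cong[where g = "\<lambda>_. undefined"]) auto
  qed
  have id: "(\<lambda>p. p) \<in> borel_measurable ?M"
    using comp by (rule measurable_coordinatewise_then_product)
  define S where "S R = {p \<in> space ?M. p \<in> orbit_angles k N \<rho> m0 K \<and> p \<in> angle_domain k \<and>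
    (\<forall>i\<in>{1..k}. - real R \<le> p i \<and> p i \<le> real R)}" for R :: nat
  have "S R \<in> null_sets ?M" for R
  proof (rule null_set_if_few_points_on_lines[where w = shear and R = "real R" and B = "N * K\<^sup>2"])
    note [measurable] = comp
    have 1: "{p \<in> space ?M. p \<in> orbit_angles k N \<rho> m0 K} \<in> sets ?M"
      using measurable_sets[OF id borel_closed[OF closed_orbit_angles[of k N \<rho> m0 K]]]
      by (simp add: vimage_def Int_def conj_commute)
    have 2: "{p \<in> space ?M. (\<forall>i\<in>{2..k}. 0 < p i \<and> p i < 2 * pi) \<and>
       (\<forall>i\<in>{2..k}. \<forall>j\<in>{2..k}. i < j \<longrightarrow> p i < p j) \<and> 
       (\<forall>i\<in>{1..k}. - real R \<le> p i \<and> p i \<le> real R)} \<in> sets ?M"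
      by measurable
    have sm: "strict_mono_on {2..k} p \<longleftrightarrow> (\<forall>i\<in>{2..k}. \<forall>j\<in>{2..k}. i < j \<longrightarrow> p i < p j)"
      for p :: "nat \<Rightarrow> real" by (auto simp: strict_mono_on_def)
    have "S R = {p \<in> space ?M. p \<in> orbit_angles k N \<rho> m0 K} \<inter>
       {p \<in> space ?M. (\<forall>i\<in>{2..k}. 0 < p i \<and> p i < 2 * pi) \<and>
       (\<forall>i\<in>{2..k}. \<forall>j\<in>{2..k}. i < j \<longrightarrow> p i < p j) \<and> 
       (\<forall>i\<in>{1..k}. - real R \<le> p i \<and> p i \<le> real R)}"
      unfolding S_def angle_domain_def sm by (simp add: set_eq_iff conj_ac)
    with 1 2 show "S R \<in> sets ?M" by (simp only: sets.Int)
    show "S R \<subseteq> Pi\<^sub>E {1..k} (\<lambda>_. {- real R..real R})"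
      by (auto simp: S_def space_PiM PiE_def)
    show "\<bar>shear i\<bar> \<le> 1" for i by (simp add: shear_def)
    show "card T \<le> N * K\<^sup>2" if "finite T" "\<And>t. t \<in> T \<Longrightarrow> (\<lambda>i\<in>{1..k}. x i + t * shear i) \<in> S R" for x T
    proof (rule orbit_angles_card_le[OF k \<open>m0 < N\<close> that(1) bij])
      show "(\<lambda>i\<in>{1..k}. x i + t * shear i) \<in> orbit_angles k N \<rho> m0 K \<inter> angle_domain k"
        if "t \<in> T" for t using \<open>\<And>t. t \<in> T \<Longrightarrow> _\<close>[OF that] by (simp add: S_def)
    qed
  qed simp
  then have "(\<Union>R. S R) \<in> null_sets ?M" by (rule null_sets_UN)
  moreover have "(\<Union>R. S R) = {p \<in> extensional {1..k}. p \<in> orbit_angles k N \<rho> m0 K \<and> p \<in> angle_domain k}"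
  proof -
    have ex: "\<exists>R. \<forall>i\<in>{1..k}. - real R \<le> p i \<and> p i \<le> real R" for p :: "nat \<Rightarrow> real"
    proof -
      obtain R where R: "(\<Sum>i\<in>{1..k}. \<bar>p i\<bar>) \<le> real R" using real_arch_simple by blast
      have "\<bar>p i\<bar> \<le> real R" if "i \<in> {1..k}" for i
        using member_le_sum[of i "{1..k}" "\<lambda>i. \<bar>p i\<bar>"] that R by simp
      then show ?thesis by (intro exI[of _ R] ballI) (simp add: abs_le_iff minus_le_iff)
    qed
    have "space ?M = extensional {1..k}" by (simp add: space_PiM PiE_def)
    with ex show ?thesis by (simp add: S_def set_eq_iff)
  qed
  ultimately show ?thesis by simp
qed

section \<open>Affine relations between points of a circle, read off from distances\<close>

text \<open>The vectors \<open>(1, cos, sin)\<close> at three distinct angles \<open>0\<close>,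
  \<open>s\<close>, \<open>t\<close> are a basis. Eliminating \<open>b1\<close> leaves a system
  solved by Cramer's rule, whose determinant \<open>d\<close> factors into sines of half
  angles.\<close>

lemma circle_basis:
  fixes s t :: real
  assumes "0 < s" "s < 2 * pi" "0 < t" "t < 2 * pi" "s \<noteq> t"
  shows "\<exists>b1 b2 b3. b1 + b2 + b3 = A \<and> b1 + b2 * cos s + b3 * cos t = B \<and> b2 * sin s + b3 * sin t = C"
proof -
  define d where "d = (cos s - 1) * sin t - (cos t - 1) * sin s"
  have half: "cos x - 1 = - 2 * (sin (x / 2))\<^sup>2" "sin x = 2 * sin (x / 2) * cos (x / 2)" for x :: real
    using cos_double_sin[of "x / 2"] sin_double[of "x / 2"] by simp_all
  have "d = 4 * sin (s / 2) * sin (t / 2) * sin (t / 2 - s / 2)"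
    unfolding d_def half[of s] half[of t] sin_diff by (simp add: power2_eq_square algebra_simps)
  moreover have "sin (s / 2) \<noteq> 0" "sin (t / 2) \<noteq> 0" "sin (t / 2 - s / 2) \<noteq> 0"
    using sin_gt_zero[of "s / 2"] sin_gt_zero[of "t / 2"] sin_eq_0_pi[of "t / 2 - s / 2"] assms by auto
  ultimately have d: "d \<noteq> 0" by simp
  define b2 b3 where "b2 = ((B - A) * sin t - C * (cos t - 1)) / d"
    and "b3 = ((cos s - 1) * C - sin s * (B - A)) / d"
  have "b2 * (cos s - 1) + b3 * (cos t - 1) = (B - A) * d / d"
    unfolding b2_def b3_def times_divide_eq_left add_divide_distrib[symmetric]
    by (rule arg_cong[where f = "\<lambda>z. z / d"]) (simp add: d_def algebra_simps)
  moreover have "b2 * sin s + b3 * sin t = C * d / d"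
    unfolding b2_def b3_def times_divide_eq_left add_divide_distrib[symmetric]
    by (rule arg_cong[where f = "\<lambda>z. z / d"]) (simp add: d_def algebra_simps)
  ultimately have "b2 * (cos s - 1) + b3 * (cos t - 1) = B - A" "b2 * sin s + b3 * sin t = C"
    using d by simp_all
  then show ?thesis
    by (intro exI[of _ "A - b2 - b3"] exI[of _ b2] exI[of _ b3]) (simp add: algebra_simps)
qed

text \<open>Leibniz's formula for the squared distance to the point with barycentric coordinates
  \<open>b1\<close>, \<open>b2\<close>, \<open>b3\<close>: a polynomial identity in each coordinate,
  then summed.\<close>

lemma sum_sq_affine_combination:
  fixes y0 y1 y2 y3 :: "nat \<Rightarrow> real" and n :: nat
  defines "D \<equiv> \<lambda>y z. \<Sum>l<n. (y l - z l)\<^sup>2"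
  assumes b: "b1 + b2 + b3 = 1"
  shows "(\<Sum>l<n. (y0 l - (b1 * y1 l + b2 * y2 l + b3 * y3 l))\<^sup>2) =
    b1 * D y1 y0 + b2 * D y2 y0 + b3 * D y3 y0 - (b1 * b2 * D y1 y2 + b1 * b3 * D y1 y3 + b2 * b3 * D y2 y3)"
proof -
  have b3: "b3 = 1 - b1 - b2" using b by simp
  have "(w - (b1 * p + b2 * q + b3 * r))\<^sup>2 = b1 * (p - w)\<^sup>2 + b2 * (q - w)\<^sup>2 + b3 * (r - w)\<^sup>2
     - (b1 * b2 * (p - q)\<^sup>2 + b1 * b3 * (p - r)\<^sup>2 + b2 * b3 * (q - r)\<^sup>2)" for w p q r
    unfolding b3 power2_eq_square by algebra
  then show ?thesis
    unfolding D_def sum_distrib_left sum.distrib[symmetric] sum_subtractf[symmetric] by simp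
qed

text \<open>For points congruent to points of a circle the term quadratic in \<open>b\<close> vanishes, so that
  the squared distance from any \<open>z\<close> is an affine function on them.\<close>

lemma sum_sq_circle_affine:
  fixes y0 y1 y2 y3 z :: "nat \<Rightarrow> real" and n :: nat
  defines "D \<equiv> \<lambda>y z. \<Sum>l<n. (y l - z l)\<^sup>2"
  assumes b: "b1 + b2 + b3 = 1" "b1 * cos t1 + b2 * cos t2 + b3 * cos t3 = cos t0"
      "b1 * sin t1 + b2 * sin t2 + b3 * sin t3 = sin t0"
    and D: "D y1 y0 = q * (1 - cos (t1 - t0))" "D y2 y0 = q * (1 - cos (t2 - t0))"
      "D y3 y0 = q * (1 - cos (t3 - t0))" "D y1 y2 = q * (1 - cos (t1 - t2))"
      "D y1 y3 = q * (1 - cos (t1 - t3))" "D y2 y3 = q * (1 - cos (t2 - t3))"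
  shows "D y0 z = b1 * D y1 z + b2 * D y2 z + b3 * D y3 z"
proof -
  have one: "cos t * cos t = 1 - sin t * sin t" for t :: real
    using sin_cos_squared_add[of t] by (simp add: power2_eq_square)
  \<comment> \<open>The sum is \<open>q / 2\<close> times one minus the squared length of the
    combination of the unit vectors at \<open>t1\<close>, \<open>t2\<close>, \<open>t3\<close>; this
    combination is the unit vector at \<open>t0\<close>.\<close>
  have quad: "b1 * b2 * D y1 y2 + b1 * b3 * D y1 y3 + b2 * b3 * D y2 y3 = 0"
    unfolding D cos_diff using b one[of t0] one[of t1] one[of t2] one[of t3] by algebra
  have lin: "b1 * D y1 y0 + b2 * D y2 y0 + b3 * D y3 y0 = 0"
    unfolding D cos_diff using b one[of t0] by algebra
  \<comment> \<open>Distances alone show that \<open>y0\<close> is the affine combination of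
    \<open>y1\<close>, \<open>y2\<close>, \<open>y3\<close>; the distance formula can then be
    applied with \<open>z\<close> in place of \<open>y0\<close>.\<close>
  have "(\<Sum>l<n. (y0 l - (b1 * y1 l + b2 * y2 l + b3 * y3 l))\<^sup>2) = 0"
    using sum_sq_affine_combination[OF b(1), where n = n and ?y0.0 = y0 and ?y1.0 = y1 and ?y2.0 = y2 and ?y3.0 = y3]
      quad lin by (simp add: D_def)
  then have "y0 l = b1 * y1 l + b2 * y2 l + b3 * y3 l" if "l < n" for l
    using that by (simp add: sum_nonneg_eq_0_iff)
  then have "D y0 z = (\<Sum>l<n. (z l - (b1 * y1 l + b2 * y2 l + b3 * y3 l))\<^sup>2)"
    unfolding D_def by (intro sum.cong) (auto simp: power2_commute)
  then show ?thesis
    using sum_sq_affine_combination[OF b(1), where n = n and ?y0.0 = z and ?y1.0 = y1 and ?y2.0 = y2 and ?y3.0 = y3] quad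
    by (simp add: D_def)
qed

lemma clockwise_angle_point:
  assumes "dist c a = r" "dist c b = r" "0 < r"
  shows "b = c + (a - c) * cis (- clockwise_angle a c b)"
proof -
  have ne: "b - c \<noteq> 0" using assms by auto
  have "norm ((a - c) / (b - c)) = 1"
    using assms by (auto simp: norm_divide dist_norm norm_minus_commute)
  then have "(a - c) / (b - c) = cis (clockwise_angle a c b)"
    using complex_norm_eq_1_exp[of "(a - c) / (b - c)"] by (simp add: clockwise_angle_def cis_conv_exp)
  then have "(a - c) * cis (- clockwise_angle a c b) = (b - c) * (cis (clockwise_angle a c b) * cis (- clockwise_angle a c b))"
    using ne by (simp add: divide_eq_eq mult_ac)
  then show ?thesis by (simp add: cis_mult)
qed

lemma dist_clockwise_angle:
  assumes "dist c a = r" "dist c b = r" "dist c b' = r" "0 < r"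
  shows "(dist b b')\<^sup>2 = 2 * r\<^sup>2 * (1 - cos (clockwise_angle a c b - clockwise_angle a c b'))"
proof -
  define s t where "s = clockwise_angle a c b" and "t = clockwise_angle a c b'"
  have "b - b' = (a - c) * (cis (- s) - cis (- t))"
    using clockwise_angle_point[OF assms(1,2,4)] clockwise_angle_point[OF assms(1,3,4)]
    unfolding s_def t_def by (metis add_diff_cancel_left right_diff_distrib)
  then have "(dist b b')\<^sup>2 = r\<^sup>2 * (norm (cis (- s) - cis (- t)))\<^sup>2"
    using assms(1) by (simp add: dist_norm norm_mult norm_minus_commute power_mult_distrib)
  also have "(norm (cis (- s) - cis (- t)))\<^sup>2 = 2 * (1 - cos (s - t))"
    unfolding cmod_power2 cos_diff using sin_cos_squared_add[of s] sin_cos_squared_add[of t]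
    by (simp add: power2_eq_square algebra_simps)
  finally show ?thesis by (simp add: s_def t_def)
qed

section \<open>Permutations and angle equations from a transitive set\<close>

lemma euclidean_dist_sq: "(euclidean_dist n y z)\<^sup>2 = (\<Sum>l<n. (y l - z l)\<^sup>2)"
  by (simp add: euclidean_dist_def L2_set_def sum_nonneg)

text \<open>A symmetry taking the first vertex to the \<open>i\<close>-th carries the distances from
  one to \<open>Z\<close> to those from the other, and these squared distances are affine in the
  point of the circle. Finiteness of \<open>Z\<close> supplies \<open>N\<close> and
  \<open>K\<close>.\<close>

lemma subtransitive_imp_orbit_angles:
  assumes cyc: "cyclic_polygon k x" and sub: "subtransitive (x ` {1..k})"
  obtains N \<rho> m0 K where "m0 < N" "\<rho> \<in> Pi\<^sub>E {2..k} (\<lambda>_. Pi\<^sub>E {..<N} (\<lambda>_. {..<N}))"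
    "\<forall>i\<in>{2..k}. bij_betw (\<rho> i) {..<N} {..<N}"
    "polygon_params k x \<in> orbit_angles k N \<rho> m0 K"
proof -
  obtain c0 r where k: "3 \<le> k" and circ: "clockwise_on_circle k x c0 r"
    using cyc by (auto simp: cyclic_polygon_def)
  have r: "0 < r" and dist_r: "\<And>i. i \<in> {1..k} \<Longrightarrow> dist c0 (x i) = r"
    and mono: "strict_mono_on {1..k} (\<lambda>i. clockwise_angle (x 1) c0 (x i))"
    using circ by (auto simp: clockwise_on_circle_def)
  define \<theta> where "\<theta> i = clockwise_angle (x 1) c0 (x i)" for i
  have params: "polygon_params k x i = \<theta> i" if "i \<in> {2..k}" for i
    using that by (simp add: polygon_params_def circumcentre_eq[OF k circ] \<theta>_def)
  have \<theta>1: "\<theta> 1 = 0"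
  proof -
    have "Arg2pi 1 = 0" by (rule Arg2pi_unique[of 1]) auto
    then show ?thesis using r dist_r[of 1] k by (auto simp: \<theta>_def clockwise_angle_def)
  qed
  have less: "\<theta> i < \<theta> j" if "i \<in> {1..k}" "j \<in> {1..k}" "i < j" for i j
    using strict_mono_onD[OF mono that] by (simp add: \<theta>_def)
  have lt2pi: "\<theta> i < 2 * pi" for i
    by (simp add: \<theta>_def clockwise_angle_def Arg2pi_lt_2pi)
  define q where "q = 2 * r\<^sup>2"
  have q: "q > 0" using r by (simp add: q_def)
  have dist_x: "(dist (x i) (x j))\<^sup>2 = q * (1 - cos (\<theta> i - \<theta> j))" if "i \<in> {1..k}" "j \<in> {1..k}" for i j
    unfolding q_def \<theta>_def using k that by (intro dist_clockwise_angle dist_r r) auto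

  obtain n Z f where Z: "finite Z" "transitive_set n Z" and fZ: "f ` x ` {1..k} \<subseteq> Z"
    and iso: "\<forall>a\<in>x ` {1..k}. \<forall>b\<in>x ` {1..k}. euclidean_dist n (f a) (f b) = dist a b"
    using sub by (auto simp: subtransitive_def)
  define y where "y i = f (x i)" for i
  have yZ: "y i \<in> Z" if "i \<in> {1..k}" for i using fZ that by (auto simp: y_def)
  define D where "D a b = (\<Sum>l<n. (a l - b l)\<^sup>2)" for a b :: "nat \<Rightarrow> real"
  have D_y: "D (y i) (y j) = q * (1 - cos (\<theta> i - \<theta> j))" if "i \<in> {1..k}" "j \<in> {1..k}" for i j
    using dist_x[OF that] iso that unfolding D_def euclidean_dist_sq[symmetric] y_def by simp

  define N where "N = card Z"
  obtain e where e: "bij_betw e {..<N} Z"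
    using ex_bij_betw_nat_finite[OF Z(1)] by (auto simp: N_def atLeast0LessThan)
  obtain m0 where m0: "m0 < N" "e m0 = y 1"
    using yZ[of 1] k bij_betw_imp_surj_on[OF e] by auto
  have "\<exists>g. euclidean_isometry n g \<and> g ` Z = Z \<and> g (y 1) = y i" if "i \<in> {1..k}" for i
    using Z(2) yZ[OF that] yZ[of 1] k by (auto simp: transitive_set_def)
  then obtain g where g: "\<And>i. i \<in> {1..k} \<Longrightarrow> euclidean_isometry n (g i)"
    "\<And>i. i \<in> {1..k} \<Longrightarrow> g i ` Z = Z" "\<And>i. i \<in> {1..k} \<Longrightarrow> g i (y 1) = y i" by metis
  have bij_g: "bij_betw (g i) Z Z" if "i \<in> {1..k}" for i
    using g(2)[OF that] Z(1) by (simp add: bij_betw_def finite_surj_inj)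
  have D_g: "D (g i a) (g i b) = D a b" if "i \<in> {1..k}" "a \<in> Z" "b \<in> Z" for i a b
  proof -
    have "Z \<subseteq> topspace (Euclidean_space n)" using Z(2) by (simp add: transitive_set_def)
    then have "euclidean_dist n (g i a) (g i b) = euclidean_dist n a b"
      using g(1)[OF that(1)] that by (auto simp: euclidean_isometry_def)
    then show ?thesis unfolding D_def euclidean_dist_sq[symmetric] by simp
  qed
  \<comment> \<open>\<open>\<rho> i m\<close> is the index of the preimage of \<open>e m\<close>
    under \<open>g i\<close>. Restricting both arguments leaves only finitely many possible
    \<open>\<rho>\<close> for given \<open>N\<close>.\<close>
  define \<rho> where "\<rho> = (\<lambda>i\<in>{2..k}. \<lambda>m\<in>{..<N}. inv_into {..<N} e (inv_into Z (g i) (e m)))"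
  have bij_\<rho>: "bij_betw (\<rho> i) {..<N} {..<N}" if "i \<in> {2..k}" for i
  proof -
    have "bij_betw (inv_into {..<N} e \<circ> (inv_into Z (g i) \<circ> e)) {..<N} {..<N}"
      using that bij_betw_trans[OF bij_betw_trans[OF e bij_betw_inv_into[OF bij_g]] bij_betw_inv_into[OF e]]
      by simp
    then show ?thesis by (rule bij_betw_cong[THEN iffD1, rotated]) (use that in \<open>simp add: \<rho>_def\<close>)
  qed
  have e_\<rho>: "g i (e (\<rho> i m)) = e m" if "i \<in> {2..k}" "m < N" for i m
  proof -
    have i: "i \<in> {1..k}" using that by auto
    have "e m \<in> Z" using e that by (auto simp: bij_betw_def)
    then have "inv_into Z (g i) (e m) \<in> Z" "g i (inv_into Z (g i) (e m)) = e m"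
      using g(2)[OF i] by (metis inv_into_into, metis f_inv_into_f)
    then show ?thesis using that bij_betw_inv_into_right[OF e] by (simp add: \<rho>_def)
  qed

  \<comment> \<open>With this scaling, coordinate \<open>m0\<close>, which belongs to the first
    vertex, is \<open>cos (\<theta> i) - 1\<close>; this yields \<open>u m0 = 1\<close>.\<close>
  define Q where "Q i m = - (D (y i) (e m)) / q" for i m
  have Q_\<rho>: "Q 1 (\<rho> i m) = Q i m" if "i \<in> {2..k}" "m < N" for i m
  proof -
    have i: "i \<in> {1..k}" using that by auto
    have "\<rho> i m < N" using bij_\<rho>[OF that(1)] that(2) by (auto simp: bij_betw_def)
    then have "e (\<rho> i m) \<in> Z" using e by (auto simp: bij_betw_def)
    then have "D (y 1) (e (\<rho> i m)) = D (y i) (e m)"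
      using D_g[OF i yZ[of 1], of "e (\<rho> i m)"] k e_\<rho>[OF that] g(3)[OF i] by simp
    then show ?thesis by (simp add: Q_def)
  qed

  have \<theta>23: "0 < \<theta> 2" "\<theta> 2 < 2 * pi" "0 < \<theta> 3" "\<theta> 3 < 2 * pi" "\<theta> 2 \<noteq> \<theta> 3"
    using less[of 1 2] less[of 1 3] less[of 2 3] lt2pi k \<theta>1 by auto
  \<comment> \<open>The coefficients \<open>a\<close>, \<open>b\<close>, \<open>d\<close> recover
    the constant, cosine and sine parts of a function from its values at
    \<open>\<theta> 1 = 0\<close>, \<open>\<theta> 2\<close> and \<open>\<theta> 3\<close>.\<close>
  obtain a1 a2 a3 where a: "a1 + a2 + a3 = 1" "a1 + a2 * cos (\<theta> 2) + a3 * cos (\<theta> 3) = 0"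
    "a2 * sin (\<theta> 2) + a3 * sin (\<theta> 3) = 0" using circle_basis[OF \<theta>23] by blast
  obtain b1 b2 b3 where b: "b1 + b2 + b3 = 0" "b1 + b2 * cos (\<theta> 2) + b3 * cos (\<theta> 3) = 1"
    "b2 * sin (\<theta> 2) + b3 * sin (\<theta> 3) = 0" using circle_basis[OF \<theta>23] by blast
  obtain d1 d2 d3 where d: "d1 + d2 + d3 = 0" "d1 + d2 * cos (\<theta> 2) + d3 * cos (\<theta> 3) = 0"
    "d2 * sin (\<theta> 2) + d3 * sin (\<theta> 3) = 1" using circle_basis[OF \<theta>23] by blast
  \<comment> \<open>The value zero from \<open>N\<close> on allows a single \<open>K\<close> to
    bound every coordinate.\<close>
  define c where "c m = (if m < N then a1 * Q 1 m + a2 * Q 2 m + a3 * Q 3 m else 0)" for m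
  define u where "u m = (if m < N then b1 * Q 1 m + b2 * Q 2 m + b3 * Q 3 m else 0)" for m
  define v where "v m = (if m < N then d1 * Q 1 m + d2 * Q 2 m + d3 * Q 3 m else 0)" for m
  have affine: "Q i m = c m + cos (\<theta> i) * u m + sin (\<theta> i) * v m" if "i \<in> {1..k}" "m < N" for i m
  proof -
    \<comment> \<open>These are the barycentric coordinates of vertex \<open>i\<close> with respect
      to the first three vertices.\<close>
    let ?w1 = "a1 + cos (\<theta> i) * b1 + sin (\<theta> i) * d1"
    let ?w2 = "a2 + cos (\<theta> i) * b2 + sin (\<theta> i) * d2"
    let ?w3 = "a3 + cos (\<theta> i) * b3 + sin (\<theta> i) * d3"
    have "D (y i) (e m) = ?w1 * D (y 1) (e m) + ?w2 * D (y 2) (e m) + ?w3 * D (y 3) (e m)"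
      unfolding D_def
    proof (rule sum_sq_circle_affine[where ?t1.0 = "\<theta> 1" and ?t2.0 = "\<theta> 2" and ?t3.0 = "\<theta> 3"
          and ?t0.0 = "\<theta> i" and q = q])
      show "?w1 + ?w2 + ?w3 = 1" using a b d by algebra
      show "?w1 * cos (\<theta> 1) + ?w2 * cos (\<theta> 2) + ?w3 * cos (\<theta> 3) = cos (\<theta> i)"
        unfolding \<theta>1 cos_zero using a b d by algebra
      show "?w1 * sin (\<theta> 1) + ?w2 * sin (\<theta> 2) + ?w3 * sin (\<theta> 3) = sin (\<theta> i)"
        unfolding \<theta>1 sin_zero using a b d by algebra
    qed (rule D_y[unfolded D_def]; use k that in simp)+
    then show ?thesis
      using that q by (simp add: Q_def c_def u_def v_def field_simps)
  qed
  have Q_m0: "Q i m0 = cos (\<theta> i) - 1" if "i \<in> {1..k}" for i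
    using D_y[OF that, of 1] k q \<theta>1 by (simp add: Q_def m0 field_simps)
  have "u m0 = 1"
    using b k \<theta>1 m0(1) by (simp add: u_def Q_m0 algebra_simps)
  obtain K :: nat where K: "(\<Sum>m<N. \<bar>c m\<bar> + \<bar>u m\<bar> + \<bar>v m\<bar>) \<le> real K"
    using real_arch_simple by blast
  have bounded: "\<bar>c m\<bar> \<le> real K \<and> \<bar>u m\<bar> \<le> real K \<and> \<bar>v m\<bar> \<le> real K" for m
  proof (cases "m < N")
    case True
    then have "\<bar>c m\<bar> + \<bar>u m\<bar> + \<bar>v m\<bar> \<le> real K"
      using member_le_sum[of m "{..<N}" "\<lambda>m. \<bar>c m\<bar> + \<bar>u m\<bar> + \<bar>v m\<bar>"] K by auto
    then show ?thesis by linarith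
  qed (simp add: c_def u_def v_def)
  have "c (\<rho> i m) + u (\<rho> i m) = c m + cos (polygon_params k x i) * u m + sin (polygon_params k x i) * v m"
    if "i \<in> {2..k}" "m < N" for i m
  proof -
    have "\<rho> i m < N" using bij_\<rho>[OF that(1)] that(2) by (auto simp: bij_betw_def)
    then show ?thesis
      using affine[of 1 "\<rho> i m"] affine[of i m] Q_\<rho>[OF that] that k \<theta>1 params[OF that(1)] by simp
  qed
  with bounded \<open>u m0 = 1\<close> have "polygon_params k x \<in> orbit_angles k N \<rho> m0 K"
    unfolding orbit_angles_def by blast
  moreover have "\<rho> \<in> Pi\<^sub>E {2..k} (\<lambda>_. Pi\<^sub>E {..<N} (\<lambda>_. {..<N}))"
  proof (rule PiE_I)
    fix i assume i: "i \<in> {2..k}"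
    show "\<rho> i \<in> Pi\<^sub>E {..<N} (\<lambda>_. {..<N})"
    proof (rule PiE_I)
      show "\<rho> i m \<in> {..<N}" if "m \<in> {..<N}" for m
        using bij_\<rho>[OF i] that by (auto simp: bij_betw_def)
    qed (use i in \<open>simp add: \<rho>_def\<close>)
  qed (auto simp: \<rho>_def)
  ultimately show thesis using that m0(1) bij_\<rho> by blast
qed

section \<open>The null set of subtransitive polygons and a polygon outside it\<close>

text \<open>The parameters lie in a union of null sets over the tuples
  \<open>(N, \<rho>, m0, K)\<close>, which are countably many because each \<open>N\<close> admits
  only finitely many extensional \<open>\<rho>\<close>.\<close>

lemma null_sets_subtransitive:
  assumes k: "12 \<le> k"
  shows "polygon_params k ` {x. cyclic_polygon k x \<and> subtransitive (x ` {1..k})}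
    \<in> null_sets (lebesgue_coords k)"
proof -
  let ?M = "\<Pi>\<^sub>M i\<in>{1..k}. (lborel :: real measure)"
  define I where "I = (SIGMA N:(UNIV :: nat set). {\<rho> \<in> Pi\<^sub>E {2..k} (\<lambda>_. Pi\<^sub>E {..<N} (\<lambda>_. {..<N})).
      \<forall>i\<in>{2..k}. bij_betw (\<rho> i) {..<N} {..<N}} \<times> {..<N} \<times> (UNIV :: nat set))"
  define S where "S = (\<lambda>(N, \<rho>, m0, K). {p \<in> extensional {1..k}. p \<in> orbit_angles k N \<rho> m0 K \<and> p \<in> angle_domain k})"
  have fin: "finite {\<rho> \<in> Pi\<^sub>E {2..k} (\<lambda>_. Pi\<^sub>E {..<N} (\<lambda>_. {..<N})).
      \<forall>i\<in>{2..k}. bij_betw (\<rho> i) {..<N} {..<N}}" for N :: nat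
    by (rule finite_subset[OF Collect_restrict]) (simp add: finite_PiE)
  have "countable I"
    unfolding I_def by (intro countable_SIGMA countable_finite[OF fin] countableI_type)
  moreover have "S z \<in> null_sets ?M" if "z \<in> I" for z
  proof -
    obtain N \<rho> m0 K where z: "z = (N, \<rho>, m0, K)" by (cases z)
    with that have "m0 < N" "\<And>i. i \<in> {2..k} \<Longrightarrow> bij_betw (\<rho> i) {..<N} {..<N}"
      by (simp_all add: I_def)
    from null_sets_orbit_angles[OF k this] show ?thesis by (simp add: S_def z)
  qed
  ultimately have "(\<Union>z\<in>I. S z) \<in> null_sets ?M" by (rule null_sets_UN')
  moreover have "polygon_params k ` {x. cyclic_polygon k x \<and> subtransitive (x ` {1..k})} \<subseteq> (\<Union>z\<in>I. S z)"
  proof clarify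
    fix x assume x: "cyclic_polygon k x" "subtransitive (x ` {1..k})"
    obtain N \<rho> m0 K where o: "m0 < N" "\<rho> \<in> Pi\<^sub>E {2..k} (\<lambda>_. Pi\<^sub>E {..<N} (\<lambda>_. {..<N}))"
      "\<forall>i\<in>{2..k}. bij_betw (\<rho> i) {..<N} {..<N}" "polygon_params k x \<in> orbit_angles k N \<rho> m0 K"
      using subtransitive_imp_orbit_angles[OF x] by metis
    have "polygon_params k x \<in> extensional {1..k} \<inter> angle_domain k"
      using polygon_params_image[of k] x(1) k by (auto simp: angle_domain_def)
    then have "polygon_params k x \<in> S (N, \<rho>, m0, K)" using o by (simp add: S_def)
    moreover have "(N, \<rho>, m0, K) \<in> I" using o by (simp add: I_def)
    ultimately show "polygon_params k x \<in> (\<Union>z\<in>I. S z)" by blast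
  qed
  \<comment> \<open>The image is only known to lie inside a null set; in the completed measure this
    makes it null.\<close>
  ultimately show ?thesis
    unfolding lebesgue_coords_def by (intro null_sets_completion_subset[OF _ null_sets_completionI])
qed

text \<open>The parameter region contains an open box of positive volume.\<close>

lemma polygon_params_image_not_null:
  "polygon_params 16 ` {x. cyclic_polygon 16 x} \<notin> null_sets (lebesgue_coords 16)"
proof
  interpret product_sigma_finite "\<lambda>_::nat. lborel :: real measure" by standard
  let ?M = "\<Pi>\<^sub>M i\<in>{1..16::nat}. (lborel :: real measure)"
  \<comment> \<open>Disjoint consecutive intervals of length \<open>1 / 8\<close> make the angles
    increase, and the last endpoint \<open>17 / 8\<close> is below \<open>2 * pi\<close>.\<close>
  define B where "B = Pi\<^sub>E {1..16::nat} (\<lambda>i. {real i / 8<..<(real i + 1) / 8})"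
  have B: "B \<in> sets ?M" unfolding B_def by (intro sets_PiM_I_finite) auto
  have "B \<subseteq> polygon_params 16 ` {x. cyclic_polygon 16 x}"
  proof
    fix p assume "p \<in> B"
    then have p: "p \<in> extensional {1..16}" and i: "\<And>i. i \<in> {1..16} \<Longrightarrow> real i / 8 < p i \<and> p i < (real i + 1) / 8"
      by (auto simp: B_def PiE_iff)
    have "p i < p j" if "i \<in> {2..16}" "j \<in> {2..16}" "i < j" for i j
      using i[of i] i[of j] that by (simp add: field_simps)
    moreover have "0 < p j \<and> p j < 2 * pi" if "j \<in> {1..16}" for j
      using i[of j] that pi_gt3 by (auto simp: field_simps)
    ultimately show "p \<in> polygon_params 16 ` {x. cyclic_polygon 16 x}"
      using p by (subst polygon_params_image) (auto simp: strict_mono_on_def)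
  qed
  moreover assume "polygon_params 16 ` {x. cyclic_polygon 16 x} \<in> null_sets (lebesgue_coords 16)"
  ultimately have "B \<in> null_sets ?M"
    using null_sets_completion_iff[OF B] null_sets_completion_subset[of B _ ?M]
    unfolding lebesgue_coords_def by simp
  moreover have "emeasure ?M B = (\<Prod>i\<in>{1..16::nat}. ennreal (1 / 8))"
    unfolding B_def by (subst emeasure_PiM) (auto simp: divide_right_mono simp flip: diff_divide_distrib)
  ultimately have "(\<Prod>i\<in>{1..16::nat}. ennreal (1 / 8)) = 0" by (simp only: null_sets_def mem_Collect_eq)
  then show False unfolding prod_zero_iff[OF finite_atLeastAtMost] by simp
qed

theorem theorem4p2:
  shows "(\<forall>k\<ge>16.
            polygon_params k ` {x. cyclic_polygon k x \<and> subtransitive (x ` {1..k})}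
              \<in> null_sets (lebesgue_coords k)) \<and>
         (\<exists>x. cyclic_polygon 16 x \<and> \<not> subtransitive (x ` {1..16}))"
proof
  show "\<forall>k\<ge>16. polygon_params k ` {x. cyclic_polygon k x \<and> subtransitive (x ` {1..k})}
      \<in> null_sets (lebesgue_coords k)"
    by (intro allI impI null_sets_subtransitive) simp
  show "\<exists>x. cyclic_polygon 16 x \<and> \<not> subtransitive (x ` {1..16})"
  proof (rule ccontr)
    assume "\<not> ?thesis"
    then have "{x. cyclic_polygon 16 x \<and> subtransitive (x ` {1..16})} = {x. cyclic_polygon 16 x}" by auto
    then show False using null_sets_subtransitive[of 16] polygon_params_image_not_null by simp
  qed
qed

end
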